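(* Let $t \geq 3$ and let $\Delta$ be a graph on $n$ vertices with exactly $t$ distinct valencies. Then there exists a connected graph on at most $2^{n+2}$ vertices whose adjacency matrix has exactly four distinct eigenvalues, which has at least $t$ distinct valencies, and which contains $\Delta$ as an induced subgraph.
   Context: Graphs are finite, simple and undirected; eigenvalues of a graph are those of its adjacency matrix; valencies are vertex degrees. *)

theory Defs
  imports Complex_Main
begin

definition graph :: "'a set \<Rightarrow> ('a \<Rightarrow> 'a \<Rightarrow> bool) \<Rightarrow> bool" where
  "graph V E \<longleftrightarrow> finite V \<and> (\<forall>u v. E u v \<longrightarrow> u \<in> V \<and> v \<in> V)
     \<and> (\<forall>u v. E u v \<longrightarrow> E v u) \<and> (\<forall>v. \<not> E v v)"

definition valency :: "'a set \<Rightarrow> ('a \<Rightarrow> 'a \<Rightarrow> bool) \<Rightarrow> 'a \<Rightarrow> nat" where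
  "valency V E v = card {u \<in> V. E v u}"

definition valencies :: "'a set \<Rightarrow> ('a \<Rightarrow> 'a \<Rightarrow> bool) \<Rightarrow> nat set" where
  "valencies V E = valency V E ` V"

definition adj_matrix :: "('a \<Rightarrow> 'a \<Rightarrow> bool) \<Rightarrow> 'a \<Rightarrow> 'a \<Rightarrow> real" where
  "adj_matrix E u v = (if E u v then 1 else 0)"

text \<open>Eigenvalue of the (V-indexed) adjacency matrix A: A x = \<lambda> x for some
nonzero vector x \<in> \<real>^V.  The adjacency matrix is real symmetric, so all its
eigenvalues are real.\<close>
definition graph_eigenvalue :: "'a set \<Rightarrow> ('a \<Rightarrow> 'a \<Rightarrow> bool) \<Rightarrow> real \<Rightarrow> bool" where
  "graph_eigenvalue V E mu \<longleftrightarrow> (\<exists>x :: 'a \<Rightarrow> real. (\<exists>v\<in>V. x v \<noteq> 0) \<and>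
      (\<forall>u\<in>V. (\<Sum>v\<in>V. adj_matrix E u v * x v) = mu * x u))"

definition eigenvalues :: "'a set \<Rightarrow> ('a \<Rightarrow> 'a \<Rightarrow> bool) \<Rightarrow> real set" where
  "eigenvalues V E = {mu. graph_eigenvalue V E mu}"

definition connected_graph :: "'a set \<Rightarrow> ('a \<Rightarrow> 'a \<Rightarrow> bool) \<Rightarrow> bool" where
  "connected_graph V E \<longleftrightarrow> V \<noteq> {} \<and> (\<forall>u\<in>V. \<forall>v\<in>V. E\<^sup>*\<^sup>* u v)"

definition induced_subgraph_of ::
  "'a set \<Rightarrow> ('a \<Rightarrow> 'a \<Rightarrow> bool) \<Rightarrow> 'b set \<Rightarrow> ('b \<Rightarrow> 'b \<Rightarrow> bool) \<Rightarrow> bool" where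
  "induced_subgraph_of V E W F \<longleftrightarrow> (\<exists>f. inj_on f V \<and> f ` V \<subseteq> W \<and>
      (\<forall>u\<in>V. \<forall>v\<in>V. F (f u) (f v) \<longleftrightarrow> E u v))"

end

theory Submission
  imports Defs
begin

text \<open>
  Let \<open>H\<close> be the \<open>m\<close>-fold Kronecker power of a symmetric \<open>4 \<times> 4\<close> Hadamard matrix with constant
  diagonal 1; its entries are \<open>(-1)\<close> to the values of a symplectic form on \<open>\<int>\<^sub>2\<^bsup>2m\<^esup>\<close>. Splitting off
  hyperbolic planes one at a time realises every graph on at most \<open>2m - 1\<close> vertices by distinct nonzero
  vectors whose symplectic products are its adjacencies. Switching \<open>H\<close> with respect to these vectors
  makes the row sums on them an injective affine function of the valencies of the given graph.

  For a graph with adjacency matrix \<open>(J - H) / 2\<close>, where \<open>H\<close> is symmetric Hadamard of order \<open>N = s\<^sup>2\<close>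
  with diagonal 1, orthogonality of rows belonging to different components shows that a
  disconnected graph has at most two valencies. If the graph is not regular, its eigenvalues are
  \<open>\<plusminus> s / 2\<close>, with eigenvectors orthogonal to the all-one vector, and the two roots of a quadratic
  equation for the remaining invariant plane.
\<close>

section \<open>Graphs of symmetric Hadamard matrices with constant diagonal\<close>

locale symmetric_hadamard =
  fixes W :: "'a set" and H :: "'a \<Rightarrow> 'a \<Rightarrow> real"
  assumes finite_W: "finite W"
    and sign: "x \<in> W \<Longrightarrow> y \<in> W \<Longrightarrow> H x y = 1 \<or> H x y = -1"
    and sym: "x \<in> W \<Longrightarrow> y \<in> W \<Longrightarrow> H x y = H y x"
    and diag: "x \<in> W \<Longrightarrow> H x x = 1"
    and orth: "x \<in> W \<Longrightarrow> y \<in> W \<Longrightarrow> (\<Sum>z\<in>W. H x z * H z y) = (if x = y then real (card W) else 0)"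
begin

definition edge :: "'a \<Rightarrow> 'a \<Rightarrow> bool" where
  "edge x y \<longleftrightarrow> x \<in> W \<and> y \<in> W \<and> H x y = -1"

definition row_sum :: "'a \<Rightarrow> real" where
  "row_sum x = (\<Sum>y\<in>W. H x y)"

lemma graph_edge: "graph W edge"
  unfolding graph_def edge_def using finite_W sym diag by force

lemma adj_matrix_edge:
  assumes "x \<in> W" "y \<in> W"
  shows "adj_matrix edge x y = (1 - H x y) / 2"
  using assms sign[OF assms] by (auto simp: adj_matrix_def edge_def)

lemma row_sum_valency:
  assumes "x \<in> W"
  shows "row_sum x = real (card W) - 2 * real (valency W edge x)"
proof -
  have "row_sum x = (\<Sum>y\<in>W. 1 - 2 * (if edge x y then 1 else 0))"
    unfolding row_sum_def
    by (intro sum.cong refl) (use sign[OF assms] assms in \<open>auto simp: edge_def\<close>)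
  also have "\<dots> = real (card W) - 2 * (\<Sum>y\<in>W. if edge x y then 1 else 0)"
    by (simp add: sum_subtractf sum_distrib_left)
  also have "(\<Sum>y\<in>W. if edge x y then 1 else 0) = real (valency W edge x)"
    using finite_W by (simp add: valency_def sum.If_cases Int_def)
  finally show ?thesis .
qed

section \<open>Connectivity from the number of valencies\<close>

text \<open>If some \<open>y0\<close> is unreachable from \<open>x0\<close>, orthogonality fixes the
  sum of any row sum from the component of \<open>x0\<close> and any row sum from outside it. Row
  sums, hence valencies, are then constant on each of the two sides.\<close>

lemma connected_if_three_valencies:
  assumes "card (valencies W edge) \<ge> 3"
  shows "connected_graph W edge"
proof (rule ccontr)
  have "W \<noteq> {}" using assms by (auto simp: valencies_def)
  moreover assume "\<not> connected_graph W edge"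
  ultimately obtain x0 y0 where xy0: "x0 \<in> W" "y0 \<in> W" "\<not> edge\<^sup>*\<^sup>* x0 y0"
    by (auto simp: connected_graph_def)
  have across: "row_sum x + row_sum y = card W"
    if x: "x \<in> W" "edge\<^sup>*\<^sup>* x0 x" and y: "y \<in> W" "\<not> edge\<^sup>*\<^sup>* x0 y" for x y
  proof -
    \<comment> \<open>This is \<open>(1 - H x z) * (1 - H y z) = 0\<close> expanded: no
      \<open>z\<close> is adjacent to both \<open>x\<close> and \<open>y\<close>, as they lie on
      different sides.\<close>
    have "H x z * H z y = H x z + H y z - 1" if z: "z \<in> W" for z
    proof (cases "edge\<^sup>*\<^sup>* x0 z")
      case True
      then have "\<not> edge z y" using y by (meson rtranclp.rtrancl_into_rtrancl)
      then have "H z y = 1" using sign[OF z y(1)] z y(1) by (auto simp: edge_def)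
      then show ?thesis using sym[OF z y(1)] by simp
    next
      case False
      then have "\<not> edge x z" using x by (meson rtranclp.rtrancl_into_rtrancl)
      then have "H x z = 1" using sign[OF x(1) z] z x(1) by (auto simp: edge_def)
      then show ?thesis using sym[OF z y(1)] by simp
    qed
    then have "(\<Sum>z\<in>W. H x z * H z y) = row_sum x + row_sum y - card W"
      by (simp add: row_sum_def sum.distrib sum_subtractf)
    moreover have "x \<noteq> y" using x y by auto
    ultimately show ?thesis using orth[OF x(1) y(1)] by simp
  qed
  have "valencies W edge \<subseteq> {valency W edge x0, valency W edge y0}"
  proof
    fix d assume "d \<in> valencies W edge"
    then obtain z where z: "z \<in> W" "d = valency W edge z" by (auto simp: valencies_def)
    have base: "row_sum x0 + row_sum y0 = card W" using across xy0 by blast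
    show "d \<in> {valency W edge x0, valency W edge y0}"
    proof (cases "edge\<^sup>*\<^sup>* x0 z")
      case True
      then have "row_sum z = row_sum x0" using across[of z y0] z xy0 base by simp
      then show ?thesis using row_sum_valency[OF z(1)] row_sum_valency[OF xy0(1)] z by simp
    next
      case False
      then have "row_sum z = row_sum y0" using across[of x0 z] z xy0 base by simp
      then show ?thesis using row_sum_valency[OF z(1)] row_sum_valency[OF xy0(2)] z by simp
    qed
  qed
  then have "card (valencies W edge) \<le> card {valency W edge x0, valency W edge y0}"
    by (intro card_mono) auto
  also have "\<dots> \<le> 2" by (simp add: card_insert_if)
  finally show False using assms by simp
qed

section \<open>The spectrum in the non-regular case\<close>

lemma adj_matrix_edge_mult:
  assumes "u \<in> W"
  shows "(\<Sum>v\<in>W. adj_matrix edge u v * x v) = (sum x W - (\<Sum>v\<in>W. H u v * x v)) / 2"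
proof -
  have "(\<Sum>v\<in>W. adj_matrix edge u v * x v) = (\<Sum>v\<in>W. (x v - H u v * x v) / 2)"
    by (intro sum.cong refl) (simp add: adj_matrix_edge assms field_simps)
  also have "\<dots> = (\<Sum>v\<in>W. x v - H u v * x v) / 2"
    by (rule sum_divide_distrib[symmetric])
  finally show ?thesis
    by (simp add: sum_subtractf)
qed

lemma H_H_mult:
  assumes "u \<in> W"
  shows "(\<Sum>v\<in>W. H u v * (\<Sum>w\<in>W. H v w * x w)) = real (card W) * x u"
proof -
  have "(\<Sum>v\<in>W. H u v * (\<Sum>w\<in>W. H v w * x w)) = (\<Sum>w\<in>W. (\<Sum>v\<in>W. H u v * H v w) * x w)"
    unfolding sum_distrib_left sum_distrib_right
    by (subst sum.swap) (simp add: mult.assoc)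
  also have "\<dots> = (\<Sum>w\<in>W. if u = w then real (card W) * x w else 0)"
    by (intro sum.cong refl) (simp add: orth assms)
  finally show ?thesis using finite_W assms by simp
qed

lemma H_row_sum:
  assumes "u \<in> W"
  shows "(\<Sum>v\<in>W. H u v * row_sum v) = real (card W)"
  using H_H_mult[OF assms, of "\<lambda>_. 1"] by (simp add: row_sum_def)

text \<open>The left side is the squared norm of \<open>H\<close> applied to the all-one vector, so
  the square of \<open>H\<close> being a scalar matrix determines it.\<close>

lemma sum_row_sum_squares: "(\<Sum>x\<in>W. row_sum x * row_sum x) = real (card W) * real (card W)"
proof -
  have "(\<Sum>x\<in>W. row_sum x * row_sum x) = (\<Sum>x\<in>W. \<Sum>y\<in>W. H x y * row_sum x)"
    by (simp add: row_sum_def sum_distrib_right)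
  also have "\<dots> = (\<Sum>y\<in>W. \<Sum>x\<in>W. H y x * row_sum x)"
    by (subst sum.swap) (intro sum.cong refl, simp add: sym)
  finally show ?thesis by (simp add: H_row_sum)
qed

text \<open>Here \<open>s\<close> is either square root of the order, so that applying the lemma to
  \<open>s\<close> and \<open>- s\<close> yields both eigenvalues of this type.\<close>

lemma eigenvalue_half_sqrt:
  assumes s: "s * s = real (card W)" and s0: "s \<noteq> 0" "s \<noteq> -2"
    and ab: "a \<in> W" "b \<in> W" "a \<noteq> b"
  shows "graph_eigenvalue W edge (- s / 2)"
proof -
  text \<open>The columns of \<open>H + s I\<close> are eigenvectors of \<open>H\<close> for \<open>s\<close>; two of them are combined to a
    vector orthogonal to the all-one vector.\<close>
  define c where "c p u = H u p + s * (if u = p then 1 else 0)" for p u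
  have c_eigen: "(\<Sum>v\<in>W. H u v * c p v) = s * c p u" if "u \<in> W" "p \<in> W" for u p
  proof -
    have "(\<Sum>v\<in>W. H u v * c p v) = (\<Sum>v\<in>W. H u v * H v p) + s * (\<Sum>v\<in>W. if v = p then H u v else 0)"
      unfolding sum_distrib_left sum.distrib[symmetric] c_def
      by (intro sum.cong refl) (simp add: algebra_simps)
    also have "\<dots> = s * c p u"
      using orth[OF that] that finite_W by (auto simp: c_def s[symmetric] algebra_simps)
    finally show ?thesis .
  qed
  have eigen: "graph_eigenvalue W edge (- s / 2)"
    if "v \<in> W" "\<alpha> * c a v + \<beta> * c b v \<noteq> 0" "\<alpha> * sum (c a) W + \<beta> * sum (c b) W = 0" for \<alpha> \<beta> v
  proof -
    define x where "x u = \<alpha> * c a u + \<beta> * c b u" for u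
    have "sum x W = 0"
      using that by (simp add: x_def sum.distrib sum_distrib_left)
    moreover have "(\<Sum>v\<in>W. H u v * x v) = s * x u" if "u \<in> W" for u
    proof -
      have "(\<Sum>v\<in>W. H u v * x v) = \<alpha> * (\<Sum>v\<in>W. H u v * c a v) + \<beta> * (\<Sum>v\<in>W. H u v * c b v)"
        unfolding sum_distrib_left sum.distrib[symmetric] x_def
        by (intro sum.cong refl) (simp add: algebra_simps)
      then show ?thesis using c_eigen that ab by (simp add: x_def algebra_simps)
    qed
    ultimately have "\<forall>u\<in>W. (\<Sum>v\<in>W. adj_matrix edge u v * x v) = - s / 2 * x u"
      by (simp add: adj_matrix_edge_mult)
    moreover have "x v \<noteq> 0" using that by (simp add: x_def)
    ultimately show ?thesis using that(1) unfolding graph_eigenvalue_def by blast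
  qed
  have ca: "c a a = 1 + s" "c b b = 1 + s" "c a b = H a b" "c b a = H a b"
    using ab diag sym by (auto simp: c_def)
  have hh: "H a b * H a b = 1" using sign[OF ab(1,2)] by auto
  \<comment> \<open>The columns \<open>c a\<close> and \<open>c b\<close> restricted to the
    coordinates \<open>a\<close> and \<open>b\<close> form a 2 by 2 matrix of determinant
    \<open>(1 + s)^2 - 1 = s * (s + 2)\<close>. Its adjugate is applied to the system.\<close>
  have indep: "\<alpha> = 0 \<and> \<beta> = 0"
    if 1: "\<alpha> * c a a + \<beta> * c b a = 0" and 2: "\<alpha> * c a b + \<beta> * c b b = 0" for \<alpha> \<beta>
  proof -
    have n0: "s * (s + 2) \<noteq> 0" using s0 by simp
    have "\<alpha> * (s * (s + 2)) = (\<alpha> * c a a + \<beta> * c b a) * (1 + s) - (\<alpha> * c a b + \<beta> * c b b) * H a b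
        + \<alpha> * (H a b * H a b - 1)"
      unfolding ca by (simp add: algebra_simps)
    then have "\<alpha> = 0" using n0 1 2 hh by simp
    moreover have "\<beta> * (s * (s + 2)) = (\<alpha> * c a b + \<beta> * c b b) * (1 + s) - (\<alpha> * c a a + \<beta> * c b a) * H a b
        + \<beta> * (H a b * H a b - 1)"
      unfolding ca by (simp add: algebra_simps)
    then have "\<beta> = 0" using n0 1 2 hh by simp
    ultimately show ?thesis by simp
  qed
  have "\<exists>\<alpha> \<beta>. (\<alpha> \<noteq> 0 \<or> \<beta> \<noteq> 0) \<and> \<alpha> * sum (c a) W + \<beta> * sum (c b) W = 0"
  proof (cases "sum (c a) W = 0")
    case True
    then show ?thesis by (intro exI[of _ 1] exI[of _ 0]) simp
  next
    case False
    then show ?thesis by (intro exI[of _ "- sum (c b) W"] exI[of _ "sum (c a) W"]) simp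
  qed
  then show ?thesis using indep eigen ab by blast
qed

lemma four_eigenvalues:
  assumes s: "s * s = real (card W)" and s2: "s > 2"
    and nonreg: "x1 \<in> W" "x2 \<in> W" "row_sum x1 \<noteq> row_sum x2"
  shows "card (eigenvalues W edge) = 4"
proof -
  define N where "N = real (card W)"
  define K where "K = sum row_sum W"
  have NN: "s * s = N" using s by (simp add: N_def)
  have N0: "N > 0" using NN s2 by (metis less_trans mult_pos_pos zero_less_numeral)
  \<comment> \<open>\<open>K\<close> is the excess of \<open>H\<close>. Its absolute value could
    reach \<open>N * s\<close> only if all row sums were equal, which non-regularity excludes; the
    sum of squared deviations from \<open>e * s\<close> makes this precise.\<close>
  have strict: "e * K < N * s" if e: "e = 1 \<or> e = -1" for e :: real
  proof -
    have "\<exists>x\<in>W. row_sum x \<noteq> e * s" using nonreg by metis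
    then have "0 < (\<Sum>x\<in>W. (row_sum x - e * s)\<^sup>2)"
      using finite_W by (auto intro: sum_pos2)
    also have "\<dots> = (\<Sum>x\<in>W. row_sum x * row_sum x - 2 * s * e * row_sum x + N)"
      by (intro sum.cong refl) (use NN e in \<open>auto simp: power2_eq_square algebra_simps\<close>)
    also have "\<dots> = N * N - 2 * s * e * K + N * N"
      by (simp add: sum.distrib sum_subtractf sum_row_sum_squares K_def N_def flip: sum_distrib_left)
    finally have "s * (e * K) < s * (N * s)"
      using NN by (simp add: algebra_simps)
    then show ?thesis using s2 by simp
  qed
  have bound: "K < N * s" "- K < N * s" using strict[of 1] strict[of "-1"] by simp_all
  \<comment> \<open>Up to the factor 4, this is the characteristic polynomial of the adjacency
    matrix on the invariant plane spanned by the all-one vector and \<open>row_sum\<close>.\<close>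
  define q where "q \<mu> = 4 * \<mu> * \<mu> - 2 * N * \<mu> + (K - N)" for \<mu> :: real
  \<comment> \<open>The roots of \<open>q\<close> stay away from the eigenvalues of absolute value
    \<open>s / 2\<close>: a coincidence would force the excess to attain its bound.\<close>
  have q_neq: "4 * \<mu> * \<mu> \<noteq> N" if "q \<mu> = 0" for \<mu>
  proof
    assume *: "4 * \<mu> * \<mu> = N"
    then have "(2 * \<mu> - s) * (2 * \<mu> + s) = 0" using NN by (simp add: algebra_simps)
    then have "2 * \<mu> = s \<or> 2 * \<mu> = - s" by auto
    moreover have "K = N * (2 * \<mu>)" using that * by (simp add: q_def algebra_simps)
    ultimately show False using bound by auto
  qed
  have spec: "graph_eigenvalue W edge \<mu> \<longleftrightarrow> \<mu> = s / 2 \<or> \<mu> = - s / 2 \<or> q \<mu> = 0" for \<mu>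
  proof
    assume "graph_eigenvalue W edge \<mu>"
    then obtain x v where v: "v \<in> W" "x v \<noteq> 0"
      and eig: "\<And>u. u \<in> W \<Longrightarrow> (\<Sum>v\<in>W. adj_matrix edge u v * x v) = \<mu> * x u"
      unfolding graph_eigenvalue_def by blast
    define \<sigma> where "\<sigma> = sum x W"
    have Hx: "(\<Sum>v\<in>W. H u v * x v) = \<sigma> - 2 * \<mu> * x u" if "u \<in> W" for u
      using eig[OF that] that by (simp add: adj_matrix_edge_mult \<sigma>_def)
    \<comment> \<open>Applying \<open>H\<close> once more to \<open>Hx\<close> and using that its
      square is \<open>N\<close> times the identity. Summing the result over \<open>u\<close> later
      gives \<open>q \<mu> = 0\<close> whenever \<open>\<sigma>\<close> is nonzero.\<close>
    have key: "(N - 4 * \<mu> * \<mu>) * x u = \<sigma> * (row_sum u - 2 * \<mu>)" if u: "u \<in> W" for u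
    proof -
      have "N * x u = (\<Sum>v\<in>W. H u v * (\<sigma> - 2 * \<mu> * x v))"
        using H_H_mult[OF u, of x] Hx by (simp add: N_def)
      also have "\<dots> = (\<Sum>v\<in>W. \<sigma> * H u v - 2 * \<mu> * (H u v * x v))"
        by (intro sum.cong refl) (simp add: algebra_simps)
      also have "\<dots> = \<sigma> * row_sum u - 2 * \<mu> * (\<sigma> - 2 * \<mu> * x u)"
        by (simp add: sum_subtractf row_sum_def Hx[OF u] flip: sum_distrib_left)
      finally show ?thesis by (simp add: algebra_simps)
    qed
    show "\<mu> = s / 2 \<or> \<mu> = - s / 2 \<or> q \<mu> = 0"
    proof (cases "\<sigma> = 0")
      case True
      then have "N - 4 * \<mu> * \<mu> = 0" using key[OF v(1)] v(2) by simp
      then have "(2 * \<mu> - s) * (2 * \<mu> + s) = 0" using NN by (simp add: algebra_simps)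
      then show ?thesis by auto
    next
      case False
      have "(N - 4 * \<mu> * \<mu>) * \<sigma> = (\<Sum>u\<in>W. (N - 4 * \<mu> * \<mu>) * x u)"
        by (simp add: \<sigma>_def sum_distrib_left)
      also have "\<dots> = (\<Sum>u\<in>W. \<sigma> * (row_sum u - 2 * \<mu>))" by (simp add: key)
      also have "\<dots> = \<sigma> * (K - 2 * \<mu> * N)"
        by (simp add: sum_subtractf K_def N_def flip: sum_distrib_left)
      finally have "\<sigma> * (N - 4 * \<mu> * \<mu>) = \<sigma> * (K - 2 * \<mu> * N)" by (simp add: mult.commute)
      then have "N - 4 * \<mu> * \<mu> = K - 2 * \<mu> * N" using False by simp
      then show ?thesis by (simp add: q_def algebra_simps)
    qed
  next
    assume "\<mu> = s / 2 \<or> \<mu> = - s / 2 \<or> q \<mu> = 0"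
    moreover have "x1 \<noteq> x2" using nonreg by auto
    then have "graph_eigenvalue W edge (- s / 2)" "graph_eigenvalue W edge (- (- s) / 2)"
      using eigenvalue_half_sqrt[of s x1 x2] eigenvalue_half_sqrt[of "- s" x1 x2] s s2 nonreg by auto
    moreover have "graph_eigenvalue W edge \<mu>" if "q \<mu> = 0"
    proof -
      \<comment> \<open>The witness is read off from \<open>key\<close>, whose right side is a
        multiple of this vector. It is nonzero because \<open>row_sum\<close> is not
        constant.\<close>
      define x where "x u = row_sum u - 2 * \<mu>" for u
      have "sum x W = K - 2 * \<mu> * N"
        by (simp add: x_def sum_subtractf K_def N_def)
      also have "\<dots> = N - 4 * \<mu> * \<mu>" using that by (simp add: q_def algebra_simps)
      finally have sx: "sum x W = N - 4 * \<mu> * \<mu>" .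
      have "(\<Sum>v\<in>W. H u v * x v) = N - 2 * \<mu> * row_sum u" if u: "u \<in> W" for u
      proof -
        have "(\<Sum>v\<in>W. H u v * x v) = (\<Sum>v\<in>W. H u v * row_sum v - 2 * \<mu> * H u v)"
          by (intro sum.cong refl) (simp add: x_def algebra_simps)
        then show ?thesis
          using H_row_sum[OF u] by (simp add: sum_subtractf row_sum_def N_def flip: sum_distrib_left)
      qed
      then have "\<forall>u\<in>W. (\<Sum>v\<in>W. adj_matrix edge u v * x v) = \<mu> * x u"
        using sx unfolding x_def[symmetric]
        by (auto simp: adj_matrix_edge_mult) (simp add: x_def algebra_simps)
      moreover have "x x1 \<noteq> 0 \<or> x x2 \<noteq> 0" using nonreg by (auto simp: x_def)
      ultimately show ?thesis using nonreg unfolding graph_eigenvalue_def by blast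
    qed
    ultimately show "graph_eigenvalue W edge \<mu>" by auto
  qed
  \<comment> \<open>A quarter of the discriminant of \<open>q\<close>. The bound on \<open>K\<close>
    puts it above \<open>N * (s - 2)^2\<close>, so the two roots are real and distinct.\<close>
  define D where "D = N * N - 4 * (K - N)"
  have "0 < (s - 2)\<^sup>2" using s2 by simp
  then have "0 < N * (s - 2)\<^sup>2" using N0 by simp
  also have "\<dots> = N * N + 4 * N - 4 * (N * s)"
    by (simp add: NN[symmetric] power2_eq_square algebra_simps)
  also have "\<dots> < D" using bound by (simp add: D_def)
  finally have D: "D > 0" .
  define r where "r e = (N + e * sqrt D) / 4" for e :: real
  have q_roots: "q \<mu> = 0 \<longleftrightarrow> \<mu> = r 1 \<or> \<mu> = r (-1)" for \<mu>
  proof -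
    have "sqrt D * sqrt D = D" using D by simp
    then have "4 * q \<mu> = (4 * \<mu> - N - sqrt D) * (4 * \<mu> - N + sqrt D)"
      by (simp add: q_def D_def algebra_simps)
    then have "q \<mu> = 0 \<longleftrightarrow> (4 * \<mu> - N - sqrt D) * (4 * \<mu> - N + sqrt D) = 0"
      by (metis mult_eq_0_iff zero_neq_numeral)
    then show ?thesis unfolding mult_eq_0_iff r_def by (auto simp: field_simps)
  qed
  have "eigenvalues W edge = {s / 2, - s / 2, r 1, r (-1)}"
    by (auto simp: eigenvalues_def spec q_roots)
  moreover have "r 1 \<noteq> r (-1)" using D by (simp add: r_def)
  moreover have "q (s / 2) \<noteq> 0" "q (- s / 2) \<noteq> 0"
    using q_neq[of "s / 2"] q_neq[of "- s / 2"] NN by auto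
  then have "s / 2 \<noteq> r 1" "s / 2 \<noteq> r (-1)" "- s / 2 \<noteq> r 1" "- s / 2 \<noteq> r (-1)"
    using q_roots by metis+
  moreover have "s / 2 \<noteq> - s / 2" using s2 by simp
  ultimately show ?thesis by simp
qed

text \<open>Conjugation by a diagonal matrix of signs keeps symmetry, the unit diagonal and
  orthogonality, but changes row sums and thereby valencies.\<close>

lemma switching:
  assumes "\<And>x. x \<in> W \<Longrightarrow> f x = 1 \<or> f x = -1"
  shows "symmetric_hadamard W (\<lambda>x y. f x * f y * H x y)"
proof
  fix x y assume xy: "x \<in> W" "y \<in> W"
  show "f x * f y * H x y = 1 \<or> f x * f y * H x y = -1"
    using assms[OF xy(1)] assms[OF xy(2)] sign[OF xy] by auto
  show "f x * f y * H x y = f y * f x * H y x" using sym[OF xy] by simp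
  have "(\<Sum>z\<in>W. f x * f z * H x z * (f z * f y * H z y)) = (\<Sum>z\<in>W. f x * f y * (H x z * H z y))"
    by (intro sum.cong refl) (use assms in force)
  also have "\<dots> = f x * f y * (\<Sum>z\<in>W. H x z * H z y)" by (simp add: sum_distrib_left)
  finally show "(\<Sum>z\<in>W. f x * f z * H x z * (f z * f y * H z y)) = (if x = y then real (card W) else 0)"
    using orth[OF xy] assms[OF xy(1)] by auto
next
  fix x assume x: "x \<in> W"
  show "f x * f x * H x x = 1" using assms[OF x] diag[OF x] by auto
qed (rule finite_W)

end

section \<open>The symplectic Hadamard matrix\<close>

text \<open>A natural number below \<open>4^m\<close> encodes a vector of \<open>\<int>\<^sub>2\<^bsup>2m\<^esup>\<close>, each base-4 digit being a
  vector of a hyperbolic plane; distinct nonzero vectors of the plane have product 1.\<close>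

definition plane_sign :: "nat \<Rightarrow> nat \<Rightarrow> real" where
  "plane_sign p q = (if p = 0 \<or> q = 0 \<or> p = q then 1 else -1)"

fun symplectic_sign :: "nat \<Rightarrow> nat \<Rightarrow> nat \<Rightarrow> real" where
  "symplectic_sign 0 x y = 1"
| "symplectic_sign (Suc m) x y =
     plane_sign (x mod 4) (y mod 4) * symplectic_sign m (x div 4) (y div 4)"

lemma symplectic_sign_cases: "symplectic_sign m x y = 1 \<or> symplectic_sign m x y = -1"
proof (induction m arbitrary: x y)
  case (Suc m)
  show ?case using Suc[of "x div 4" "y div 4"] by (auto simp: plane_sign_def)
qed simp

lemma symplectic_sign_commute: "symplectic_sign m x y = symplectic_sign m y x"
  by (induction m arbitrary: x y) (auto simp: plane_sign_def)

lemma symplectic_sign_self [simp]: "symplectic_sign m x x = 1"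
  by (induction m arbitrary: x) (auto simp: plane_sign_def)

lemma symplectic_sign_zero [simp]: "symplectic_sign m 0 x = 1" "symplectic_sign m x 0 = 1"
  by (induction m arbitrary: x) (auto simp: plane_sign_def)

lemma symplectic_sign_digit:
  assumes "p < 4" "q < 4"
  shows "symplectic_sign (Suc m) (4 * x + p) (4 * y + q) = plane_sign p q * symplectic_sign m x y"
  using assms by simp

lemma sum_lessThan_four_mult:
  fixes f :: "nat \<Rightarrow> real"
  shows "sum f {..<4 * n} = (\<Sum>x<n. \<Sum>p<4. f (4 * x + p))"
  by (induction n) (simp_all add: eval_nat_numeral algebra_simps)

lemma plane_sign_orth:
  assumes "p < 4" "q < 4"
  shows "(\<Sum>r<4. plane_sign p r * plane_sign r q) = (if p = q then 4 else 0)"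
proof -
  have "p = 0 \<or> p = 1 \<or> p = 2 \<or> p = 3" "q = 0 \<or> q = 1 \<or> q = 2 \<or> q = 3" using assms by auto
  then show ?thesis
    by (elim disjE) (simp_all add: plane_sign_def eval_nat_numeral)
qed

text \<open>Splitting off the last base-4 digit of \<open>z\<close> factors the sum into one over a
  hyperbolic plane and one over the remaining digits, as for any Kronecker product.\<close>

lemma symplectic_sign_orth:
  assumes "x < 4 ^ m" "y < 4 ^ m"
  shows "(\<Sum>z<4 ^ m. symplectic_sign m x z * symplectic_sign m z y) = (if x = y then 4 ^ m else 0)"
  using assms
proof (induction m arbitrary: x y)
  case (Suc m)
  have lt: "x div 4 < 4 ^ m" "y div 4 < 4 ^ m" using Suc.prems by auto
  let ?p = "x mod 4" and ?q = "y mod 4"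
  have "(\<Sum>z<4 ^ Suc m. symplectic_sign (Suc m) x z * symplectic_sign (Suc m) z y) =
      (\<Sum>z<4 ^ m. \<Sum>r<4. (symplectic_sign m (x div 4) z * symplectic_sign m z (y div 4))
        * (plane_sign ?p r * plane_sign r ?q))"
    unfolding power_Suc sum_lessThan_four_mult
    by (intro sum.cong refl) simp
  also have "\<dots> = (\<Sum>r<4. plane_sign ?p r * plane_sign r ?q) *
      (if x div 4 = y div 4 then 4 ^ m else 0)"
    unfolding sum_distrib_left[symmetric] sum_distrib_right[symmetric] Suc.IH[OF lt] by (rule mult.commute)
  also have "(\<Sum>r<4. plane_sign ?p r * plane_sign r ?q) = (if ?p = ?q then 4 else 0)"
    by (rule plane_sign_orth) auto
  also have "(if ?p = ?q then 4 else 0) * (if x div 4 = y div 4 then 4 ^ m else 0)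
      = (if x = y then 4 ^ Suc m else (0::real))"
  proof -
    have "x = y \<longleftrightarrow> ?p = ?q \<and> x div 4 = y div 4" by (metis mult_div_mod_eq)
    then show ?thesis by simp
  qed
  finally show ?case .
qed auto

lemma symmetric_hadamard_symplectic_sign: "symmetric_hadamard {..<4 ^ m} (symplectic_sign m)"
proof
  fix x y :: nat assume "x \<in> {..<4 ^ m}" "y \<in> {..<4 ^ m}"
  then show "(\<Sum>z<4 ^ m. symplectic_sign m x z * symplectic_sign m z y)
      = (if x = y then real (card {..<4 ^ m :: nat}) else 0)"
    using symplectic_sign_orth[of x m y] by simp
qed (use symplectic_sign_cases symplectic_sign_commute in auto)

text \<open>Row 0 is the all-one row, and every other row is orthogonal to it.\<close>

lemma sum_symplectic_sign_eq_0:
  assumes "0 < x" "x < 4 ^ m"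
  shows "(\<Sum>z<4 ^ m. symplectic_sign m x z) = 0"
  using symplectic_sign_orth[OF assms(2), of 0] assms(1) by simp

section \<open>Representing graphs by symplectic products\<close>

text \<open>The vector 0 is excluded as a value because its row is the only one with nonzero sum
  before switching.\<close>

definition represents ::
  "nat \<Rightarrow> 'a set \<Rightarrow> ('a \<Rightarrow> 'a \<Rightarrow> bool) \<Rightarrow> ('a \<Rightarrow> nat) \<Rightarrow> bool" where
  "represents m V E v \<longleftrightarrow> inj_on v V \<and> v ` V \<subseteq> {0<..<4 ^ m} \<and>
     (\<forall>x\<in>V. \<forall>y\<in>V. symplectic_sign m (v x) (v y) = (if E x y then -1 else 1))"

text \<open>The edge \<open>a b\<close> is sent to the hyperbolic pair 1, 2 of a new plane. Every
  other \<open>x\<close> gets the digit of that plane whose products with 1 and 2 record its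
  adjacency to \<open>a\<close> and \<open>b\<close>. The higher digits must then realise adjacency
  corrected by the product of the two new digits, with \<open>\<noteq>\<close> on truth values
  serving as addition modulo 2.\<close>

lemma represents_edge_step:
  assumes sym: "\<And>x y. E x y \<Longrightarrow> E y x" and irr: "\<And>x. \<not> E x x" and ab: "E a b"
    and w: "represents m (V - {a, b})
      (\<lambda>x y. E x y \<noteq> ((E x a \<and> E y b) \<noteq> (E x b \<and> E y a))) w"
  shows "represents (Suc m) V E (\<lambda>x. if x = a then 1 else if x = b then 2
    else 4 * w x + ((if E x b then 1 else 0) + (if E x a then 2 else 0)))"
proof -
  let ?U = "V - {a, b}"
  define p where "p x = (if E x b then 1 else 0) + (if E x a then 2 else (0::nat))" for x
  define v where "v x = (if x = a then 1 else if x = b then 2 else 4 * w x + p x)" for x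
  have neq: "a \<noteq> b" "E b a" using ab irr sym by auto
  have p4: "p x < 4" for x by (simp add: p_def)
  have w': "inj_on w ?U" "\<And>x. x \<in> ?U \<Longrightarrow> 0 < w x \<and> w x < 4 ^ m"
    "\<And>x y. x \<in> ?U \<Longrightarrow> y \<in> ?U \<Longrightarrow> symplectic_sign m (w x) (w y)
      = (if E x y \<noteq> ((E x a \<and> E y b) \<noteq> (E x b \<and> E y a)) then -1 else 1)"
    using w unfolding represents_def by (auto simp: image_subset_iff)
  \<comment> \<open>As \<open>w x\<close> is nonzero, these codes cannot collide with the codes 1
    and 2 of \<open>a\<close> and \<open>b\<close>, and division by 4 recovers
    \<open>w x\<close>.\<close>
  have big: "4 \<le> v x" "v x < 4 * 4 ^ m" "v x div 4 = w x" if "x \<in> ?U" for x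
    using w'(2)[OF that] p4[of x] that by (auto simp: v_def)
  have small: "v a = 1" "v b = 2" using neq by (auto simp: v_def)
  have range: "v x \<in> {0<..<4 ^ Suc m}" if x: "x \<in> V" for x
  proof (cases "x \<in> ?U")
    case True
    then show ?thesis using big by fastforce
  next
    case False
    then have "v x = 1 \<or> v x = 2" using x small by auto
    moreover have "(2::nat) < 4 * 4 ^ m" using one_le_power[of "4::nat" m] by linarith
    ultimately show ?thesis by auto
  qed
  have inj: "inj_on v V"
  proof (rule inj_onI)
    fix x y assume *: "x \<in> V" "y \<in> V" "v x = v y"
    consider "x \<in> ?U" "y \<in> ?U" | "x \<in> ?U" "y \<in> {a, b}" | "x \<in> {a, b}" "y \<in> ?U" | "x \<in> {a, b}" "y \<in> {a, b}"
      using * by blast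
    then show "x = y"
    proof cases
      case 1
      then have "w x = w y" using big(3) * by metis
      then show ?thesis using w'(1) 1 by (auto dest: inj_onD)
    next
      case 2
      then show ?thesis using big(1)[of x] small * by auto
    next
      case 3
      then show ?thesis using big(1)[of y] small * by auto
    next
      case 4
      then show ?thesis using small * by auto
    qed
  qed
  have EU: "symplectic_sign (Suc m) (v x) (v y) = (if E x y then -1 else 1)"
    if "x \<in> ?U" "y \<in> ?U" for x y
  proof -
    have "symplectic_sign (Suc m) (v x) (v y) = plane_sign (p x) (p y) * symplectic_sign m (w x) (w y)"
      using that symplectic_sign_digit[OF p4 p4] by (auto simp: v_def)
    then show ?thesis unfolding w'(3)[OF that] by (auto simp: plane_sign_def p_def)
  qed
  have Ea: "symplectic_sign (Suc m) (v x) 1 = (if E x a then -1 else 1)"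
    and Eb: "symplectic_sign (Suc m) (v x) 2 = (if E x b then -1 else 1)" if "x \<in> ?U" for x
    using that p4[of x] by (auto simp: v_def plane_sign_def p_def)
  have Ea': "symplectic_sign (Suc m) 1 (v x) = (if E a x then -1 else 1)"
    and Eb': "symplectic_sign (Suc m) 2 (v x) = (if E b x then -1 else 1)" if "x \<in> ?U" for x
    using Ea[OF that] Eb[OF that] sym symplectic_sign_commute by metis+
  have Eab: "symplectic_sign (Suc m) 1 2 = -1" "symplectic_sign (Suc m) 2 1 = -1"
    by (simp_all add: plane_sign_def)
  have "symplectic_sign (Suc m) (v x) (v y) = (if E x y then -1 else 1)" if *: "x \<in> V" "y \<in> V" for x y
  proof -
    consider "x \<in> ?U" "y \<in> ?U" | "x \<in> ?U" "y \<in> {a, b}" | "x \<in> {a, b}" "y \<in> ?U" | "x \<in> {a, b}" "y \<in> {a, b}"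
      using * by blast
    then show ?thesis
    proof cases
      case 1
      then show ?thesis by (rule EU)
    next
      case 2
      then show ?thesis using Ea[OF 2(1)] Eb[OF 2(1)] small by auto
    next
      case 3
      then show ?thesis using Ea'[OF 3(2)] Eb'[OF 3(2)] small by auto
    next
      case 4
      then show ?thesis using Eab small ab neq irr
        by (auto simp del: symplectic_sign.simps)
    qed
  qed
  then have "represents (Suc m) V E v"
    using range inj unfolding represents_def by blast
  then show ?thesis unfolding v_def p_def .
qed

text \<open>The end of the splitting process: without edges, any distinct nonzero vectors of a
  totally isotropic subspace will do, and one of dimension \<open>m\<close> has
  \<open>2 ^ m - 1\<close> of them.\<close>

lemma represents_no_edges:
  assumes "finite V" "card V < 2 ^ m" and no: "\<And>x y. x \<in> V \<Longrightarrow> y \<in> V \<Longrightarrow> \<not> E x y"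
  shows "\<exists>v. represents m V E v"
proof -
  text \<open>Numbers with all base-4 digits in \<open>{0, 1}\<close> form a totally isotropic subspace.\<close>
  have "\<exists>S. S \<subseteq> {..<4 ^ m} \<and> card S = 2 ^ m \<and> 0 \<in> S \<and> (\<forall>x\<in>S. \<forall>y\<in>S. symplectic_sign m x y = 1)"
  proof (induction m)
    case 0
    show ?case by (intro exI[of _ "{0}"]) auto
  next
    case (Suc m)
    then obtain S where S: "S \<subseteq> {..<4 ^ m}" "card S = 2 ^ m" "0 \<in> S"
      "\<And>x y. x \<in> S \<Longrightarrow> y \<in> S \<Longrightarrow> symplectic_sign m x y = 1" by blast
    define T where "T = (\<lambda>x. 4 * x) ` S \<union> (\<lambda>x. 4 * x + 1) ` S"
    have "finite S" using S(1) finite_subset by blast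
    moreover have "4 * x \<noteq> 4 * y + 1" for x y :: nat by presburger
    then have "(\<lambda>x. 4 * x) ` S \<inter> (\<lambda>x. 4 * x + 1) ` S = {}" by blast
    ultimately have "card T = 2 ^ Suc m"
      unfolding T_def using S(2)
      by (subst card_Un_disjoint) (auto simp: card_image inj_on_def)
    moreover have "T \<subseteq> {..<4 ^ Suc m}"
    proof -
      have "4 * x + 1 < 4 * 4 ^ m" if "x \<in> S" for x :: nat
        using S(1) that by (auto dest!: subsetD)
      then show ?thesis unfolding T_def by fastforce
    qed
    moreover have "\<forall>x\<in>T. \<forall>y\<in>T. symplectic_sign (Suc m) x y = 1"
    proof -
      have "\<exists>x'\<in>S. \<exists>p<2. x = 4 * x' + p" if "x \<in> T" for x
        using that by (force simp: T_def)
      moreover have "symplectic_sign (Suc m) (4 * x + p) (4 * y + q) = 1"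
        if "x \<in> S" "y \<in> S" "p < 2" "q < 2" for x y p q
        using S(4) that by (subst symplectic_sign_digit) (auto simp: plane_sign_def)
      ultimately show ?thesis by metis
    qed
    moreover have "0 \<in> T" using S(3) by (auto simp: T_def)
    ultimately show ?case by blast
  qed
  then obtain S where S: "S \<subseteq> {..<4 ^ m}" "card S = 2 ^ m" "0 \<in> S"
    "\<And>x y. x \<in> S \<Longrightarrow> y \<in> S \<Longrightarrow> symplectic_sign m x y = 1" by blast
  have finS: "finite S" using S(1) finite_subset by blast
  then have "card V \<le> card (S - {0})" using S assms(2) by simp
  then obtain v where v: "inj_on v V" "v ` V \<subseteq> S - {0}"
    using card_le_inj[of V "S - {0}"] assms(1) finS by auto
  have "v ` V \<subseteq> {0<..<4 ^ m}" using v(2) S(1) by fastforce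
  moreover have "symplectic_sign m (v x) (v y) = 1" if "x \<in> V" "y \<in> V" for x y
    using S(4) v(2) that by blast
  ultimately show ?thesis using v(1) no unfolding represents_def by auto
qed

text \<open>Each edge step removes two vertices at the cost of one plane, so the bound is inherited;
  for \<open>m = 0\<close> it cannot hold. Once no edge is left, the isotropic subspace is large
  enough because \<open>2 * m \<le> 2 ^ m\<close> for positive \<open>m\<close>.\<close>

lemma ex_represents:
  assumes "finite V" "card V < 2 * m" "\<And>x y. E x y \<Longrightarrow> E y x" "\<And>x. \<not> E x x"
  shows "\<exists>v. represents m V E v"
  using assms
proof (induction m arbitrary: V E)
  case (Suc m)
  show ?case
  proof (cases "\<exists>a\<in>V. \<exists>b\<in>V. E a b")
    case True
    then obtain a b where ab: "a \<in> V" "b \<in> V" "E a b" by blast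
    then have "a \<noteq> b" using Suc.prems(4) by auto
    then have "card V = Suc (Suc (card (V - {a, b})))"
      using ab Suc.prems(1)
      by (metis Diff_insert card_Suc_Diff1 finite_Diff insert_Diff insert_iff)
    then have "card (V - {a, b}) < 2 * m" using Suc.prems(2) by simp
    then have "\<exists>w. represents m (V - {a, b}) (\<lambda>x y. E x y \<noteq> ((E x a \<and> E y b) \<noteq> (E x b \<and> E y a))) w"
      using Suc.prems by (intro Suc.IH) (simp, assumption, metis, metis)
    then show ?thesis
      using represents_edge_step[where E = E and a = a and b = b, OF Suc.prems(3,4) ab(3)] by blast
  next
    case False
    have "2 * Suc m \<le> 2 ^ Suc m" by (induction m) auto
    then show ?thesis using Suc.prems False by (intro represents_no_edges) auto
  qed
qed simp

section \<open>Switching along the representing vectors\<close>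

theorem theorem8:
  fixes V :: "'a set" and E :: "'a \<Rightarrow> 'a \<Rightarrow> bool" and t :: nat
  assumes "graph V E"
    and "card (valencies V E) = t"
    and "t \<ge> 3"
  shows "\<exists>(W :: nat set) F. graph W F \<and> connected_graph W F
           \<and> card W \<le> 2 ^ (card V + 2)
           \<and> card (eigenvalues W F) = 4
           \<and> card (valencies W F) \<ge> t
           \<and> induced_subgraph_of V E W F"
proof -
  have V: "finite V" "\<And>x y. E x y \<Longrightarrow> E y x" "\<And>x. \<not> E x x"
    using assms(1) by (auto simp: graph_def)
  \<comment> \<open>The least \<open>m\<close> with \<open>card V < 2 * m\<close>; it also satisfies
    \<open>2 * m \<le> card V + 2\<close>, which gives the bound on the order
    \<open>4 ^ m\<close>.\<close>
  define m where "m = Suc (card V div 2)"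
  have "card V \<ge> 3" using card_image_le[OF V(1), of "valency V E"] assms by (simp add: valencies_def)
  then have m2: "m \<ge> 2" by (simp add: m_def)
  have "\<exists>v. represents m V E v" 
    by (rule ex_represents[where E = E, OF V(1) _ V(2,3)]) (simp_all add: m_def)
  then obtain v where v: "inj_on v V" "v ` V \<subseteq> {0<..<4 ^ m}"
    "\<And>x y. x \<in> V \<Longrightarrow> y \<in> V \<Longrightarrow> symplectic_sign m (v x) (v y) = (if E x y then -1 else 1)"
    unfolding represents_def by metis
  define W :: "nat set" where "W = {..<4 ^ m}"
  define f where "f x = (if x \<in> v ` V then -1 else (1::real))" for x
  define H where "H = (\<lambda>x y. f x * f y * symplectic_sign m x y)"
  interpret S: symmetric_hadamard W "symplectic_sign m"
    unfolding W_def by (rule symmetric_hadamard_symplectic_sign)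
  interpret symmetric_hadamard W H
    unfolding H_def by (rule S.switching) (simp add: f_def)
  have vW: "v x \<in> W" if "x \<in> V" for x using v(2) that by (auto simp: W_def)
  have row: "row_sum (v x) = 2 * real (card V) - 4 * real (valency V E x)" if x: "x \<in> V" for x
  proof -
    have "row_sum (v x) = (\<Sum>y\<in>W. - symplectic_sign m (v x) y
        + 2 * (if y \<in> v ` V then symplectic_sign m (v x) y else 0))"
      unfolding row_sum_def by (intro sum.cong refl) (use x in \<open>auto simp: H_def f_def\<close>)
    also have "\<dots> = - (\<Sum>y\<in>W. symplectic_sign m (v x) y)
        + 2 * (\<Sum>y\<in>W. if y \<in> v ` V then symplectic_sign m (v x) y else 0)"
      unfolding sum.distrib sum_negf sum_distrib_left ..
    also have "(\<Sum>y\<in>W. symplectic_sign m (v x) y) = 0"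
      unfolding W_def using v(2) x by (intro sum_symplectic_sign_eq_0) auto
    also have "(\<Sum>y\<in>W. if y \<in> v ` V then symplectic_sign m (v x) y else 0)
        = (\<Sum>y\<in>v ` V. symplectic_sign m (v x) y)"
    proof -
      have "W \<inter> v ` V = v ` V" using vW by auto
      then show ?thesis using finite_W by (simp flip: sum.inter_restrict)
    qed
    also have "\<dots> = (\<Sum>y\<in>V. 1 - 2 * (if E x y then 1 else 0))"
      using v(1,3) x by (simp add: sum.reindex) (intro sum.cong refl, auto)
    also have "\<dots> = real (card V) - 2 * (\<Sum>y\<in>V. if E x y then 1 else 0)"
      by (simp add: sum_subtractf sum_distrib_left)
    also have "(\<Sum>y\<in>V. if E x y then 1 else 0) = real (valency V E x)"
      using V(1) by (simp add: valency_def sum.If_cases Int_def)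
    finally show ?thesis by simp
  qed
  have "t \<le> card (valencies W edge)"
  proof -
    \<comment> \<open>The valency in the new graph of the image of a vertex of valency
      \<open>d\<close>, from \<open>row\<close> and \<open>row_sum_valency\<close>.\<close>
    define g where "g d = (2 * real d + real (card W) / 2 - real (card V))" for d
    have "inj g" by (auto simp: g_def inj_def)
    have "g ` valencies V E \<subseteq> real ` valencies W edge"
    proof
      fix d assume "d \<in> g ` valencies V E"
      then obtain x where x: "x \<in> V" "d = g (valency V E x)" by (auto simp: valencies_def)
      then have "d = real (valency W edge (v x))"
        using row[OF x(1)] row_sum_valency[OF vW[OF x(1)]] by (simp add: g_def)
      then show "d \<in> real ` valencies W edge" using vW[OF x(1)] by (auto simp: valencies_def)
    qed
    moreover have "finite (real ` valencies W edge)" using finite_W by (simp add: valencies_def)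
    ultimately have "card (g ` valencies V E) \<le> card (real ` valencies W edge)"
      by (intro card_mono)
    then show ?thesis
      using assms(2) \<open>inj g\<close> by (simp add: card_image inj_on_def inj_def)
  qed
  moreover have "card (eigenvalues W edge) = 4"
  proof -
    have "\<exists>x1\<in>V. \<exists>x2\<in>V. valency V E x1 \<noteq> valency V E x2"
    proof (rule ccontr)
      assume *: "\<not> ?thesis"
      have "valencies V E \<noteq> {}" using assms by auto
      then obtain x where x: "x \<in> V" by (auto simp: valencies_def)
      have "valencies V E \<subseteq> {valency V E x}" using * x unfolding valencies_def by blast
      then have "card (valencies V E) \<le> card {valency V E x}" by (intro card_mono) simp_all
      then show False using assms by simp
    qed
    then obtain x1 x2 where x12: "x1 \<in> V" "x2 \<in> V" "valency V E x1 \<noteq> valency V E x2" by blast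
    show ?thesis
    proof (rule four_eigenvalues)
      show "2 ^ m * 2 ^ m = real (card W)" by (simp add: W_def flip: power_mult_distrib)
      \<comment> \<open>Three valencies need at least three vertices, whence
        \<open>m \<ge> 2\<close> and \<open>s = 2 ^ m\<close> exceeds 2 as the spectral lemma
        requires.\<close>
      have "(2::real) ^ 2 \<le> 2 ^ m" using m2 by (intro power_increasing) auto
      then show "(2::real) < 2 ^ m" by simp
      show "row_sum (v x1) \<noteq> row_sum (v x2)" using x12 row by simp
    qed (use x12 vW in auto)
  qed
  moreover have "connected_graph W edge"
    using calculation(1) assms(3) by (intro connected_if_three_valencies) simp
  moreover have "card W \<le> 2 ^ (card V + 2)"
  proof -
    have "card W = (2 ^ 2) ^ m" by (simp add: W_def)
    also have "\<dots> = 2 ^ (2 * m)" by (rule power_mult[symmetric])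
    also have "\<dots> \<le> 2 ^ (card V + 2)" by (intro power_increasing) (auto simp: m_def)
    finally show ?thesis .
  qed
  moreover have "induced_subgraph_of V E W edge"
    unfolding induced_subgraph_of_def
  proof (intro exI conjI ballI)
    show "inj_on v V" by (rule v(1))
    show "v ` V \<subseteq> W" using vW by auto
    show "edge (v x) (v y) \<longleftrightarrow> E x y" if "x \<in> V" "y \<in> V" for x y
      using that vW v(3)[OF that] unfolding edge_def by (auto simp: H_def f_def)
  qed
  ultimately show ?thesis using graph_edge by blast
qed

end
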